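(* Let $\gamma : I \to \mathbb{E}^3$ be a unit speed curve of osculating order $3$ with Bishop frame $\{T, M_1, M_2\}$ and Bishop curvatures $k_1, k_2$. If $\gamma$ is of type Bishop $AW(1)$, then for all $s \in I$ $$k_1''(s) - k_1^3(s) - k_1(s) k_2^2(s) = 0,$$ $$k_2''(s) - k_2^3(s) - k_1^2(s) k_2(s) = 0.$$ Moreover, a solution of this system of differential equations is $$k_1(s) = k_2(s) = \pm\frac{1}{s+c}, \qquad c \in \mathbb{R},$$ that is, for either choice of sign these functions satisfy the system wherever $s + c \neq 0$.
   Context: $I \subset \mathbb{R}$ is an interval, $\mathbb{E}^3$ is Euclidean 3-space, curves are smooth, and primes denote derivatives with respect to the arc length parameter $s$. A unit speed curve satisfies $\|\gamma'(s)\| = 1$. It is of (osculating) order $3$ if $\gamma'(s), \gamma''(s), \gamma'''(s)$ are linearly independent for all $s$. A Bishop frame (parallel transport frame) along $\gamma$ is an orthonormal frame $\{T, M_1, M_2\}$ with $T = \gamma'$ satisfying $$T' = k_1 M_1 + k_2 M_2, \qquad M_1' = -k_1 T, \qquad M_2' = -k_2 T,$$ where the functions $k_1, k_2$ are called the first and second Bishop curvatures. Write $$\overline{N}_3 = \left(k_1'' - k_1^3 - k_1 k_2^2\right) M_1 + \left(k_2'' - k_2^3 - k_1^2 k_2\right) M_2.$$ The curve is of type Bishop $AW(1)$ if $\overline{N}_3(s) = 0$ for all $s \in I$. *)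

theory Defs
  imports "HOL-Analysis.Analysis"
begin

(* Derivatives are taken within the domain, so that they are one-sided at an endpoint
   that belongs to the domain. *)
primrec nderiv :: "real set \<Rightarrow> nat \<Rightarrow> (real \<Rightarrow> 'a::real_normed_vector) \<Rightarrow> real \<Rightarrow> 'a" where
  "nderiv I 0 f = f"
| "nderiv I (Suc n) f = (\<lambda>s. vector_derivative (nderiv I n f) (at s within I))"

definition smooth_on :: "real set \<Rightarrow> (real \<Rightarrow> 'a::real_normed_vector) \<Rightarrow> bool" where
  "smooth_on I f \<longleftrightarrow> (\<forall>n. nderiv I n f differentiable_on I)"

definition unit_speed_curve :: "real set \<Rightarrow> (real \<Rightarrow> real^3) \<Rightarrow> bool" where
  "unit_speed_curve I \<gamma> \<longleftrightarrow> smooth_on I \<gamma> \<and> (\<forall>s\<in>I. norm (nderiv I 1 \<gamma> s) = 1)"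

(* Injectivity is needed because independence of a set does not see repeated vectors. *)
definition osculating_order_3 :: "real set \<Rightarrow> (real \<Rightarrow> real^3) \<Rightarrow> bool" where
  "osculating_order_3 I \<gamma> \<longleftrightarrow>
     (\<forall>s\<in>I. inj_on (\<lambda>n. nderiv I n \<gamma> s) {1..3} \<and> independent ((\<lambda>n. nderiv I n \<gamma> s) ` {1..3}))"

(* Only differentiability of the frame is required.  If \<gamma> is smooth, then smoothness of
   M1, M2, k1, k2 follows from ki = T' \<bullet> Mi and Mi' = - ki T. *)
definition bishop_frame ::
  "real set \<Rightarrow> (real \<Rightarrow> real^3) \<Rightarrow> (real \<Rightarrow> real^3) \<Rightarrow> (real \<Rightarrow> real^3) \<Rightarrow> (real \<Rightarrow> real^3) \<Rightarrow>
   (real \<Rightarrow> real) \<Rightarrow> (real \<Rightarrow> real) \<Rightarrow> bool" where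
  "bishop_frame I \<gamma> T M1 M2 k1 k2 \<longleftrightarrow>
     (\<forall>s\<in>I.
        norm (T s) = 1 \<and> norm (M1 s) = 1 \<and> norm (M2 s) = 1 \<and>
        T s \<bullet> M1 s = 0 \<and> T s \<bullet> M2 s = 0 \<and> M1 s \<bullet> M2 s = 0 \<and>
        T s = nderiv I 1 \<gamma> s \<and>
        (T has_vector_derivative (k1 s *\<^sub>R M1 s + k2 s *\<^sub>R M2 s)) (at s within I) \<and>
        (M1 has_vector_derivative (- k1 s *\<^sub>R T s)) (at s within I) \<and>
        (M2 has_vector_derivative (- k2 s *\<^sub>R T s)) (at s within I))"

definition bishop_N3 ::
  "real set \<Rightarrow> (real \<Rightarrow> real^3) \<Rightarrow> (real \<Rightarrow> real^3) \<Rightarrow> (real \<Rightarrow> real) \<Rightarrow> (real \<Rightarrow> real) \<Rightarrow>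
   real \<Rightarrow> real^3" where
  "bishop_N3 I M1 M2 k1 k2 s =
     (nderiv I 2 k1 s - k1 s ^ 3 - k1 s * k2 s ^ 2) *\<^sub>R M1 s +
     (nderiv I 2 k2 s - k2 s ^ 3 - k1 s ^ 2 * k2 s) *\<^sub>R M2 s"

definition bishop_AW1 ::
  "real set \<Rightarrow> (real \<Rightarrow> real^3) \<Rightarrow> (real \<Rightarrow> real^3) \<Rightarrow> (real \<Rightarrow> real) \<Rightarrow> (real \<Rightarrow> real) \<Rightarrow> bool" where
  "bishop_AW1 I M1 M2 k1 k2 \<longleftrightarrow> (\<forall>s\<in>I. bishop_N3 I M1 M2 k1 k2 s = 0)"

end

theory Submission
  imports Defs
begin

text \<open>
  Both equations of the first part are the coordinates of the vector \<open>bishop_N3\<close> in the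
  orthonormal pair \<open>M1 s\<close>, \<open>M2 s\<close>. A vanishing combination of two orthonormal vectors has
  vanishing coefficients, so \<open>bishop_AW1\<close> is nothing but the system itself.

  For the second part, the \<open>n\<close>-th derivative of \<open>s \<mapsto> \<epsilon> / (s + c)\<close> is
  \<open>\<epsilon> * (-1) ^ n * n! / (s + c) ^ (n + 1)\<close>, which exists for every \<open>n\<close> away from the pole. In
  particular \<open>k'' = 2 * \<epsilon> / (s + c) ^ 3\<close>. With \<open>k1 = k2 = k\<close> both equations read
  \<open>k'' = 2 * k ^ 3\<close>, which holds because \<open>\<epsilon> ^ 3 = \<epsilon>\<close> for \<open>\<epsilon> = 1\<close> and \<open>\<epsilon> = -1\<close>.
\<close>

lemma orthonormal_combination_eq_0:
  fixes u v :: "'a::real_inner"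
  assumes "norm u = 1" "norm v = 1" "u \<bullet> v = 0" and "a *\<^sub>R u + b *\<^sub>R v = 0"
  shows "a = 0" "b = 0"
proof -
  have "(a *\<^sub>R u + b *\<^sub>R v) \<bullet> u = a" "(a *\<^sub>R u + b *\<^sub>R v) \<bullet> v = b"
    using assms(1-3) by (simp_all add: inner_add_left inner_commute[of v u] norm_eq_1)
  then show "a = 0" "b = 0"
    unfolding assms(4) by simp_all
qed

text \<open>
  Iterated derivatives are taken within \<open>I\<close>, so \<open>nderiv I n f\<close> is determined only on \<open>I\<close>, and
  only where derivatives within \<open>I\<close> are unique; hence the nontriviality of the filter. Under
  this proviso a guessed sequence of derivatives need only be checked one step at a time.
\<close>

lemma nderiv_eq_derivative_sequence:
  assumes nontriv: "\<And>s. s \<in> I \<Longrightarrow> at s within I \<noteq> bot"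
    and base: "\<And>s. s \<in> I \<Longrightarrow> f s = F 0 s"
    and step: "\<And>n s. s \<in> I \<Longrightarrow> (F n has_vector_derivative F (Suc n) s) (at s within I)"
    and "s \<in> I"
  shows "nderiv I n f s = F n s"
  using \<open>s \<in> I\<close>
proof (induction n arbitrary: s)
  case 0
  then show ?case by (simp add: base)
next
  case (Suc n)
  have "(nderiv I n f has_vector_derivative F (Suc n) s) (at s within I)"
    using Suc.prems Suc.IH step[OF Suc.prems] by (rule has_vector_derivative_transform)
  then show ?case
    using vector_derivative_within[OF nontriv[OF Suc.prems]] by simp
qed

lemma smooth_on_derivative_sequence:
  assumes "\<And>s. s \<in> I \<Longrightarrow> at s within I \<noteq> bot"
    and "\<And>s. s \<in> I \<Longrightarrow> f s = F 0 s"
    and step: "\<And>n s. s \<in> I \<Longrightarrow> (F n has_vector_derivative F (Suc n) s) (at s within I)"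
  shows "smooth_on I f"
  unfolding smooth_on_def
proof
  fix n
  show "nderiv I n f differentiable_on I"
    unfolding differentiable_on_def
  proof
    fix s
    assume s: "s \<in> I"
    have "nderiv I n f t = F n t" if "t \<in> I" for t
      by (rule nderiv_eq_derivative_sequence[where F = F, OF assms that])
    from has_vector_derivative_transform[OF s this step[OF s]]
    show "nderiv I n f differentiable (at s within I)"
      by (rule differentiableI_vector)
  qed
qed

definition reciprocal_derivs :: "real \<Rightarrow> real \<Rightarrow> nat \<Rightarrow> real \<Rightarrow> real" where
  "reciprocal_derivs \<epsilon> c n s = \<epsilon> * (-1) ^ n * fact n / (s + c) ^ Suc n"

lemma reciprocal_derivs_has_vector_derivative:
  assumes "s + c \<noteq> 0"
  shows "(reciprocal_derivs \<epsilon> c n has_vector_derivative reciprocal_derivs \<epsilon> c (Suc n) s)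
    (at s within J)"
proof -
  let ?C = "\<epsilon> * (-1) ^ n * fact n"
  have "((\<lambda>s. inverse (s + c)) has_real_derivative - (inverse (s + c) * inverse (s + c)))
      (at s within J)"
    using assms by (auto intro!: derivative_eq_intros)
  from DERIV_cmult[OF DERIV_power[OF this, of "Suc n"], of ?C]
  have "((\<lambda>s. ?C * inverse (s + c) ^ Suc n) has_real_derivative
      ?C * (real (Suc n) * - (inverse (s + c) * inverse (s + c)) * inverse (s + c) ^ n))
      (at s within J)"
    by (simp add: algebra_simps)
  also have "(\<lambda>s. ?C * inverse (s + c) ^ Suc n) = reciprocal_derivs \<epsilon> c n"
    by (rule ext) (simp only: reciprocal_derivs_def divide_inverse power_inverse)
  also have "?C * (real (Suc n) * - (inverse (s + c) * inverse (s + c)) * inverse (s + c) ^ n) =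
      reciprocal_derivs \<epsilon> c (Suc n) s"
    by (simp only: reciprocal_derivs_def divide_inverse power_inverse[symmetric] fact_Suc power_Suc)
      (simp add: mult_ac power_inverse)
  finally show ?thesis
    unfolding has_real_derivative_iff_has_vector_derivative .
qed

lemma open_reciprocal_domain: "open {s::real. s + c \<noteq> 0}"
  by (intro open_Collect_neq continuous_intros)

lemma
  fixes c \<epsilon> :: real
  defines "J \<equiv> {s. s + c \<noteq> 0}" and "k \<equiv> (\<lambda>s. \<epsilon> * (1 / (s + c)))"
  shows smooth_on_reciprocal: "smooth_on J k"
    and nderiv_2_reciprocal: "s \<in> J \<Longrightarrow> nderiv J 2 k s = 2 * \<epsilon> / (s + c) ^ 3"
proof -
  have nontriv: "at s within J \<noteq> bot" if "s \<in> J" for s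
    using that open_reciprocal_domain[of c] at_within_open[of s J]
    by (simp add: J_def)
  have base: "k s = reciprocal_derivs \<epsilon> c 0 s" for s
    by (simp add: k_def reciprocal_derivs_def)
  have step: "(reciprocal_derivs \<epsilon> c n has_vector_derivative reciprocal_derivs \<epsilon> c (Suc n) s)
      (at s within J)" if "s \<in> J" for n s
    using that by (intro reciprocal_derivs_has_vector_derivative) (simp add: J_def)
  show "smooth_on J k"
    by (rule smooth_on_derivative_sequence[where F = "reciprocal_derivs \<epsilon> c", OF nontriv base step])
  show "nderiv J 2 k s = 2 * \<epsilon> / (s + c) ^ 3" if "s \<in> J"
    using nderiv_eq_derivative_sequence[where F = "reciprocal_derivs \<epsilon> c", OF nontriv base step that, of 2]
    by (simp add: reciprocal_derivs_def eval_nat_numeral)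
qed

theorem proposition4p8:
  shows "(\<forall>(I :: real set) (\<gamma> :: real \<Rightarrow> real^3) T M1 M2 k1 k2.
            is_interval I \<and> interior I \<noteq> {} \<and>
            unit_speed_curve I \<gamma> \<and> osculating_order_3 I \<gamma> \<and>
            bishop_frame I \<gamma> T M1 M2 k1 k2 \<and> bishop_AW1 I M1 M2 k1 k2 \<longrightarrow>
            (\<forall>s\<in>I. nderiv I 2 k1 s - k1 s ^ 3 - k1 s * k2 s ^ 2 = 0 \<and>
                   nderiv I 2 k2 s - k2 s ^ 3 - k1 s ^ 2 * k2 s = 0)) \<and>
         (\<forall>c :: real. \<forall>\<epsilon>\<in>{1, -1 :: real}. \<forall>k1 k2 :: real \<Rightarrow> real. \<forall>J.
            J = {s. s + c \<noteq> 0} \<and> k1 = (\<lambda>s. \<epsilon> * (1 / (s + c))) \<and> k2 = k1 \<longrightarrow>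
            smooth_on J k1 \<and> smooth_on J k2 \<and>
            (\<forall>s\<in>J. nderiv J 2 k1 s - k1 s ^ 3 - k1 s * k2 s ^ 2 = 0 \<and>
                   nderiv J 2 k2 s - k2 s ^ 3 - k1 s ^ 2 * k2 s = 0))"
proof (intro conjI allI impI ballI)
  fix I :: "real set" and \<gamma> T M1 M2 :: "real \<Rightarrow> real^3" and k1 k2 :: "real \<Rightarrow> real" and s
  assume h: "is_interval I \<and> interior I \<noteq> {} \<and>
      unit_speed_curve I \<gamma> \<and> osculating_order_3 I \<gamma> \<and>
      bishop_frame I \<gamma> T M1 M2 k1 k2 \<and> bishop_AW1 I M1 M2 k1 k2" and s: "s \<in> I"
  have frame: "norm (M1 s) = 1" "norm (M2 s) = 1" "M1 s \<bullet> M2 s = 0"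
    using h s by (auto simp: bishop_frame_def)
  have N3: "(nderiv I 2 k1 s - k1 s ^ 3 - k1 s * k2 s ^ 2) *\<^sub>R M1 s +
      (nderiv I 2 k2 s - k2 s ^ 3 - k1 s ^ 2 * k2 s) *\<^sub>R M2 s = 0"
    using h s by (auto simp: bishop_AW1_def bishop_N3_def)
  show "nderiv I 2 k1 s - k1 s ^ 3 - k1 s * k2 s ^ 2 = 0"
    and "nderiv I 2 k2 s - k2 s ^ 3 - k1 s ^ 2 * k2 s = 0"
    using orthonormal_combination_eq_0[OF frame N3] by auto
next
  fix c \<epsilon> :: real and k1 k2 :: "real \<Rightarrow> real" and J
  assume \<epsilon>: "\<epsilon> \<in> {1, -1}"
    and h: "J = {s. s + c \<noteq> 0} \<and> k1 = (\<lambda>s. \<epsilon> * (1 / (s + c))) \<and> k2 = k1"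
  show "smooth_on J k1" and "smooth_on J k2"
    using h smooth_on_reciprocal[of c \<epsilon>] by auto
  fix s
  assume s: "s \<in> J"
  have cube: "\<epsilon> ^ 3 = \<epsilon>"
    using \<epsilon> by auto
  have k'': "nderiv J 2 k1 s = 2 * \<epsilon> / (s + c) ^ 3"
    using h s nderiv_2_reciprocal[of s c \<epsilon>] by auto
  have k3: "k1 s ^ 3 = \<epsilon> / (s + c) ^ 3"
    using h by (simp add: power_divide cube)
  have "nderiv J 2 k1 s = 2 * k1 s ^ 3"
    unfolding k'' k3 by simp
  then show "nderiv J 2 k1 s - k1 s ^ 3 - k1 s * k2 s ^ 2 = 0"
    and "nderiv J 2 k2 s - k2 s ^ 3 - k1 s ^ 2 * k2 s = 0"
    using h by (simp_all add: power2_eq_square power3_eq_cube)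
qed

end
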